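(* Let $k\subseteq L\subseteq K$ be purely inseparable extensions. Then $di(L/k)\le di(K/k)$. Moreover, $di(K/k)=\sup_{L} di(L/k)$, where $L$ ranges over all intermediate fields $k\subseteq L\subseteq K$.
   Context: All fields are commutative of characteristic $p>0$. A subset $B\subseteq K$ is an $r$-base of $K/k$ if $K=k(K^p)(B)$ and, for every $x\in B$, $x\notin k(K^p)(B\setminus\{x\})$; every extension has an $r$-base and all $r$-bases of a given extension have the same cardinality. For a purely inseparable extension $K/k$ and $n\ge 1$, put $k_n=k^{p^{-n}}\cap K=\{x\in K: x^{p^n}\in k\}$ and let $B_n$ be an $r$-base of $k_n/k$. The degree of irrationality of $K/k$ is the cardinal $di(K/k)=\sup_{n\ge 1}|B_n|$. Suprema are taken in the class of cardinals. *)

theory Defs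
  imports "HOL-Algebra.Generated_Fields"
begin

unbundle cardinal_syntax

text \<open>Cardinals are cardinal orders in the sense of \<^const>\<open>Card_order\<close>, compared up to
  \<open>=o\<close>. Since \<open>\<le>o\<close> is heterogeneous, the competing upper bounds \<open>t\<close> below are necessarily
  restricted to the type of the family itself; \<open>is_card_Sup_least\<close> shows that the result is the
  least upper bound among the cardinals of every type.\<close>

definition is_card_Sup :: "'a rel set \<Rightarrow> 'a rel \<Rightarrow> bool" where
  "is_card_Sup S r \<longleftrightarrow> Card_order r \<and> (\<forall>s\<in>S. s \<le>o r) \<and>
     (\<forall>t :: 'a rel. Card_order t \<and> (\<forall>s\<in>S. s \<le>o t) \<longrightarrow> r \<le>o t)"

definition card_Sup :: "'a rel set \<Rightarrow> 'a rel" where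
  "card_Sup S = (SOME r. is_card_Sup S r)"

lemma is_card_Sup_card_Sup:
  fixes S :: "'a rel set"
  assumes "\<And>s. s \<in> S \<Longrightarrow> Card_order s"
  shows "is_card_Sup S (card_Sup S)"
proof -
  let ?U = "{t :: 'a rel. Card_order t \<and> (\<forall>s\<in>S. s \<le>o t)}"
  have "s \<le>o |UNIV :: 'a set|" if "s \<in> S" for s
    using ordIso_ordLeq_trans[OF ordIso_symmetric[OF card_of_Field_ordIso[OF assms[OF that]]]
        card_of_mono1[OF subset_UNIV]] .
  then have "|UNIV :: 'a set| \<in> ?U"
    by (simp add: card_of_Card_order)
  then have "\<exists>r\<in>?U. \<forall>t\<in>?U. r \<le>o t"
    by (intro exists_minim_Card_order) auto
  then have "\<exists>r. is_card_Sup S r"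
    by (auto simp: is_card_Sup_def)
  then show ?thesis
    unfolding card_Sup_def by (rule someI_ex)
qed

lemma is_card_Sup_least:
  fixes S :: "'a rel set" and t :: "'b rel"
  assumes r: "is_card_Sup S r" and t: "Card_order t" and ub: "\<And>s. s \<in> S \<Longrightarrow> s \<le>o t"
  shows "r \<le>o t"
proof (rule ccontr)
  assume "\<not> r \<le>o t"
  have rC: "Card_order r" using r by (simp add: is_card_Sup_def)
  then have "t \<le>o r"
    using \<open>\<not> r \<le>o t\<close> t by (meson card_order_on_well_order_on ordLeq_total)
  then have "|Field t| \<le>o |Field r|"
    by (rule card_of_mono2)
  then obtain f where f: "inj_on f (Field t)" "f ` Field t \<subseteq> Field r"
    by (auto simp: card_of_ordLeq[symmetric])
  have iso: "t =o |f ` Field t|"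
    using ordIso_transitive[OF ordIso_symmetric[OF card_of_Field_ordIso[OF t]]
        card_of_ordIsoI[OF inj_on_imp_bij_betw[OF f(1)]]] .
  have "s \<le>o |f ` Field t|" if "s \<in> S" for s
    using ordLeq_ordIso_trans[OF ub[OF that] iso] .
  then have "r \<le>o |f ` Field t|"
    using r by (simp add: is_card_Sup_def card_of_Card_order)
  then have "r \<le>o t"
    using ordLeq_ordIso_trans ordIso_symmetric[OF iso] by blast
  with \<open>\<not> r \<le>o t\<close> show False ..
qed

text \<open>Field extensions are pairs of subfields of an ambient field \<open>R\<close>. As
  \<^const>\<open>generate_field\<close> uses only the operations of \<open>R\<close>, the notions below depend only on the
  two subfields; the case of \<open>K\<close> without ambient field is \<open>K = carrier R\<close>.\<close>

text \<open>\<^const>\<open>group.ord\<close> is \<open>0\<close> for elements of infinite order.\<close>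

definition ring_char :: "('a, 'b) ring_scheme \<Rightarrow> nat" where
  "ring_char R = group.ord (add_monoid R) \<one>\<^bsub>R\<^esub>"

definition adjoin :: "('a, 'b) ring_scheme \<Rightarrow> 'a set \<Rightarrow> 'a set \<Rightarrow> 'a set" where
  "adjoin R k S = generate_field R (k \<union> S)"

definition char_powers :: "('a, 'b) ring_scheme \<Rightarrow> 'a set \<Rightarrow> 'a set" where
  "char_powers R K = (\<lambda>x. x [^]\<^bsub>R\<^esub> ring_char R) ` K"

definition r_base :: "('a, 'b) ring_scheme \<Rightarrow> 'a set \<Rightarrow> 'a set \<Rightarrow> 'a set \<Rightarrow> bool" where
  "r_base R K k B \<longleftrightarrow> B \<subseteq> K \<and>
     K = adjoin R (adjoin R k (char_powers R K)) B \<and>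
     (\<forall>x\<in>B. x \<notin> adjoin R (adjoin R k (char_powers R K)) (B - {x}))"

definition purely_inseparable :: "('a, 'b) ring_scheme \<Rightarrow> 'a set \<Rightarrow> 'a set \<Rightarrow> bool" where
  "purely_inseparable R K k \<longleftrightarrow> (\<forall>x\<in>K. \<exists>n::nat. x [^]\<^bsub>R\<^esub> (ring_char R ^ n) \<in> k)"

definition root_subfield :: "('a, 'b) ring_scheme \<Rightarrow> 'a set \<Rightarrow> 'a set \<Rightarrow> nat \<Rightarrow> 'a set" where
  "root_subfield R K k n = {x \<in> K. x [^]\<^bsub>R\<^esub> (ring_char R ^ n) \<in> k}"

text \<open>The choice of r-base is immaterial, since all r-bases of an extension are equipotent.\<close>

definition irrationality_degree :: "('a, 'b) ring_scheme \<Rightarrow> 'a set \<Rightarrow> 'a set \<Rightarrow> 'a rel" where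
  "irrationality_degree R K k =
     card_Sup {|SOME B. r_base R (root_subfield R K k n) k B| | n. n \<ge> 1}"

end

theory Submission
  imports Defs "HOL-Computational_Algebra.Primes" "HOL-Algebra.Finite_Extensions"
    "HOL-Algebra.Free_Abelian_Groups"
begin

text \<open>
  The second claim follows from the first one, because \<open>K\<close> is one of the intermediate fields.
  For the first claim it suffices to compare, for each \<open>n\<close>, an r-base of \<open>L\<^sub>n/k\<close> with one of
  \<open>K\<^sub>n/k\<close>; here \<open>L\<^sub>n \<subseteq> K\<^sub>n\<close> and both extensions have exponent at most \<open>n\<close>. So let \<open>K/k\<close> have
  bounded exponent, let \<open>k \<subseteq> L \<subseteq> K\<close>, and let \<open>B\<close>, \<open>C\<close> be r-bases of \<open>K/k\<close> and \<open>L/k\<close>. Bounded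
  exponent gives \<open>K = k(B)\<close> (\<open>r_base_generates\<close>).

  Over a field \<open>M\<close>, elements whose \<open>p\<close>-th power lies in \<open>M\<close> satisfy the exchange law
  (\<open>adjoin_exchange\<close>), so generation over \<open>M\<close> is a matroid on them, and an r-base of \<open>L/k\<close> is a
  basis of \<open>L\<close> in the matroid over \<open>k(L\<^sup>p)\<close>. This gives the existence of r-bases by Zorn's lemma
  (\<open>r_base_exists\<close>). It also shows that the rank of \<open>L\<close> over \<open>k(L\<^sup>p)\<close> does not drop when \<open>L\<close>
  is enlarged to \<open>L(x)\<close> with \<open>x\<^sup>p \<in> L\<close> (\<open>p_independent_step\<close>): the base field grows by the
  single element \<open>x\<^sup>p\<close>, which costs an independent set at most one member, and \<open>x\<close> itself makes
  up for it. Climbing from \<open>k(D)\<close> to \<open>k(F)\<close> by such steps, a finite subset \<open>D\<close> of \<open>C\<close> that is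
  contained in \<open>k(F)\<close> with \<open>F\<close> finite has at most \<open>card F\<close> elements
  (\<open>p_independent_finite_bound\<close>).

  If \<open>B\<close> is finite, take \<open>F = B\<close>. If \<open>B\<close> is infinite, \<open>C\<close> is the union over the finite
  \<open>F \<subseteq> B\<close> of the finite sets \<open>C \<inter> k(F)\<close>, and there are only \<open>|B|\<close> many such \<open>F\<close>. Either way
  \<open>|C| \<le> |B|\<close> (\<open>r_base_card_mono\<close>).
\<close>

section \<open>The Frobenius map\<close>

lemma (in cring) binomial:
  assumes x: "x \<in> carrier R" and y: "y \<in> carrier R"
  shows "(x \<oplus> y) [^] (n::nat) = (\<Oplus>i\<in>{..n}. [(n choose i)] \<cdot> (x [^] i \<otimes> y [^] (n - i)))"
proof (induction n)
  case 0
  then show ?case by simp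
next
  case (Suc n)
  let ?t = "\<lambda>n i. [(n choose i)] \<cdot> (x [^] i \<otimes> y [^] (n - i))"
  have X: "(\<Oplus>i\<in>{..n}. ?t n i) \<otimes> x = (\<Oplus>i\<in>{..n}. [(n choose i)] \<cdot> (x [^] Suc i \<otimes> y [^] (n - i)))"
    apply (subst finsum_ldistr)
    using x y by (auto intro!: finsum_cong' simp: add_pow_ldistr add_pow_rdistr m_ac)
  have Y: "(\<Oplus>i\<in>{..n}. ?t n i) \<otimes> y = (\<Oplus>i\<in>{..n}. [(n choose i)] \<cdot> (x [^] i \<otimes> y [^] (Suc n - i)))"
    apply (subst finsum_ldistr)
    using x y by (auto intro!: finsum_cong' simp: add_pow_ldistr add_pow_rdistr m_ac Suc_diff_le)
  have Y': "\<dots> = (\<Oplus>i\<in>{..Suc n}. [(n choose i)] \<cdot> (x [^] i \<otimes> y [^] (Suc n - i)))"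
    using x y by (subst finsum_Suc) (auto simp: binomial_eq_0 simp del: nat_pow_Suc)
  have Y'': "\<dots> = (\<Oplus>i\<in>{..n}. [(n choose Suc i)] \<cdot> (x [^] Suc i \<otimes> y [^] (n - i))) \<oplus> y [^] Suc n"
    using x y by (subst finsum_Suc2) (auto simp del: nat_pow_Suc)
  have "(x \<oplus> y) [^] Suc n = (\<Oplus>i\<in>{..n}. ?t n i) \<otimes> x \<oplus> (\<Oplus>i\<in>{..n}. ?t n i) \<otimes> y"
    using x y by (simp add: Suc r_distr finsum_closed)
  also have "\<dots> = (\<Oplus>i\<in>{..n}. [(n choose i)] \<cdot> (x [^] Suc i \<otimes> y [^] (n - i)))
     \<oplus> ((\<Oplus>i\<in>{..n}. [(n choose Suc i)] \<cdot> (x [^] Suc i \<otimes> y [^] (n - i))) \<oplus> y [^] Suc n)"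
    unfolding X Y Y' Y'' ..
  also have "\<dots> = (\<Oplus>i\<in>{..n}. [(n choose i)] \<cdot> (x [^] Suc i \<otimes> y [^] (n - i))
     \<oplus> [(n choose Suc i)] \<cdot> (x [^] Suc i \<otimes> y [^] (n - i))) \<oplus> y [^] Suc n"
    using x y by (subst finsum_addf) (auto simp: a_assoc finsum_closed simp del: nat_pow_Suc)
  also have "\<dots> = (\<Oplus>i\<in>{..n}. ?t (Suc n) (Suc i)) \<oplus> y [^] Suc n"
    using x y by (intro arg_cong2[where f = "(\<oplus>)"] refl finsum_cong')
      (auto simp: add.nat_pow_mult simp del: nat_pow_Suc)
  also have "\<dots> = (\<Oplus>i\<in>{..Suc n}. ?t (Suc n) i)"
    using x y by (subst finsum_Suc2) (auto simp del: nat_pow_Suc)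
  finally show ?case .
qed

text \<open>Stated for arbitrary commutative rings because it is applied both to the field and to its
polynomial ring.\<close>

lemma (in cring) frobenius_add:
  assumes x: "x \<in> carrier R" and y: "y \<in> carrier R" and p: "Factorial_Ring.prime p" and c: "[p] \<cdot> \<one> = \<zero>"
  shows "(x \<oplus> y) [^] (p::nat) = x [^] p \<oplus> y [^] p"
proof -
  let ?t = "\<lambda>i. [(p choose i)] \<cdot> (x [^] i \<otimes> y [^] (p - i))"
  obtain q where q: "p = Suc q" using p prime_gt_0_nat gr0_implies_Suc by blast
  have z: "?t i = \<zero>" if i: "i \<in> {1..q}" for i
  proof -
    have "p dvd (p choose i)" using i q p by (intro dvd_choose_prime) auto
    then obtain m where m: "p choose i = p * m" by blast
    have "[(p choose i)] \<cdot> \<one> = \<zero>" unfolding m by (simp flip: add.nat_pow_pow add: c)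
    then have "([(p choose i)] \<cdot> \<one>) \<otimes> (x [^] i \<otimes> y [^] (p - i)) = \<zero>" using x y by simp
    then show ?thesis using x y by (simp add: add_pow_ldistr)
  qed
  have "(x \<oplus> y) [^] p = (\<Oplus>i\<in>{..p}. ?t i)" using binomial[OF x y] .
  also have "\<dots> = (\<Oplus>i\<in>{..p}. (if p = i then x [^] p else \<zero>) \<oplus> (if 0 = i then y [^] p else \<zero>))"
    using x y q z by (intro finsum_cong') (auto simp del: nat_pow_Suc binomial_Suc_Suc)
  also have "\<dots> = x [^] p \<oplus> y [^] p"
    using x y by (subst finsum_addf) (auto simp: add.finprod_singleton[of _ _ "\<lambda>_. _"] add.finprod_singleton_swap[of _ _ "\<lambda>_. _"])
  finally show ?thesis .
qed

lemma (in ring) subfield_pow_closed: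
  assumes "subfield N R" "x \<in> N"
  shows "x [^] (n::nat) \<in> N"
  using assms(2) subringE(3,6)[OF subfieldE(1)[OF assms(1)]] by (induction n) auto

locale positive_char_field = field R for R (structure) +
  assumes char_pos: "ring_char R > 0"
begin

abbreviation p :: nat where "p \<equiv> ring_char R"

lemma char_dvd_iff: "[(n::nat)] \<cdot> \<one> = \<zero> \<longleftrightarrow> p dvd n"
  using group.pow_eq_id[OF a_group, of \<one> n] by (simp add: ring_char_def add_pow_def)

lemma prime_char: "Factorial_Ring.prime p"
  unfolding prime_nat_iff
proof (intro conjI allI impI)
  have "p \<noteq> 1" using char_dvd_iff[of 1] by auto
  then show "1 < p" using char_pos by simp
  fix m assume "m dvd p"
  then obtain k where k: "p = m * k" by blast
  have "([m] \<cdot> \<one>) \<otimes> ([k] \<cdot> \<one>) = [p] \<cdot> \<one>"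
    by (simp add: k add_pow_ldistr add.nat_pow_pow mult.commute)
  then have "[m] \<cdot> \<one> = \<zero> \<or> [k] \<cdot> \<one> = \<zero>"
    using char_dvd_iff[of p] integral[of "[m] \<cdot> \<one>" "[k] \<cdot> \<one>"] by simp
  then have "p dvd m \<or> p dvd k" by (simp add: char_dvd_iff)
  then show "m = 1 \<or> m = p"
    using k char_pos by (metis dvd_antisym dvd_triv_left dvd_triv_right mult_cancel2 mult_1 nat_neq_iff)
qed

lemma frobenius_pow_add:
  assumes "x \<in> carrier R" "y \<in> carrier R"
  shows "(x \<oplus> y) [^] (p ^ n) = x [^] (p ^ n) \<oplus> y [^] (p ^ n)"
proof (induction n)
  case (Suc n)
  have *: "z [^] (p ^ Suc n) = (z [^] (p ^ n)) [^] p" if "z \<in> carrier R" for z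
    using that by (simp add: nat_pow_pow mult.commute)
  show ?case
    using assms prime_char char_dvd_iff[of p]
    by (simp add: * Suc frobenius_add del: power_Suc)
qed (use assms in simp)

text \<open>The way to show that the \<open>p\<^sup>n\<close>-th powers of all elements of a generated field lie in \<open>E\<close>: this is
then only to be checked on generators.\<close>

lemma subfield_frobenius_preimage:
  assumes E: "subfield E R"
  shows "subfield {x \<in> carrier R. x [^] (p ^ n) \<in> E} R"
proof -
  note sr = subringE[OF subfieldE(1)[OF E]]
  have p0: "p ^ n \<noteq> 0" using char_pos by simp
  have neg: "(\<ominus> x) [^] (p ^ n) = \<ominus> (x [^] (p ^ n))" if x: "x \<in> carrier R" for x
  proof -
    have "(\<ominus> x) [^] (p ^ n) \<oplus> x [^] (p ^ n) = \<zero> [^] (p ^ n)"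
      using frobenius_pow_add[of "\<ominus> x" x n] x by (simp add: l_neg)
    then show ?thesis using x p0 by (simp add: nat_pow_zero minus_equality)
  qed
  have inv: "(inv x) [^] (p ^ n) = inv (x [^] (p ^ n))" if x: "x \<in> carrier R" "x \<noteq> \<zero>" for x
  proof -
    have u: "x \<in> Units R" using x field_Units by auto
    have "(inv x) [^] (p ^ n) \<otimes> x [^] (p ^ n) = \<one>"
      using u x by (simp add: nat_pow_distrib[symmetric])
    then show ?thesis using u x by (metis Units_inv_closed comm_inv_char m_comm nat_pow_closed)
  qed
  show ?thesis
  proof (intro subfieldI' subringI)
    fix x assume "x \<in> {x \<in> carrier R. x [^] (p ^ n) \<in> E} - {\<zero>}"
    then have x: "x \<in> carrier R" "x \<noteq> \<zero>" "x [^] (p ^ n) \<in> E" by auto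
    then have "x [^] (p ^ n) \<noteq> \<zero>"
      using Units_pow_closed[of x "p ^ n"] field_Units by auto
    then have "inv (x [^] (p ^ n)) \<in> E" using subfield_m_inv[OF E] x by blast
    then show "inv x \<in> {x \<in> carrier R. x [^] (p ^ n) \<in> E}"
      using x inv by (simp add: field_Units)
  qed (use sr p0 in \<open>auto simp: frobenius_pow_add neg nat_pow_distrib nat_pow_zero\<close>)
qed

end

section \<open>Exchange for adjoining an element whose p-th power is in the base\<close>

text \<open>A divisor of \<open>(X - x)\<^sup>n\<close> is a constant times a power of \<open>X - x\<close>; evaluating at \<open>0\<close> states this
without naming the quotient, and is the form in which it yields a power of \<open>x\<close> in the field of
coefficients of \<open>g\<close>. In the induction the linear factor splits off \<open>g\<close> or \<open>h\<close>, whichever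
vanishes at \<open>x\<close>.\<close>

lemma (in field) eval_zero_divisor_linear_power:
  assumes x: "x \<in> carrier R" and g: "g \<in> carrier (poly_ring R)" and h: "h \<in> carrier (poly_ring R)"
    and gh: "g \<otimes>\<^bsub>poly_ring R\<^esub> h = [\<one>, \<ominus> x] [^]\<^bsub>poly_ring R\<^esub> (n::nat)"
  shows "eval g \<zero> = lead_coeff g \<otimes> (\<ominus> x) [^] degree g"
  using g h gh
proof (induction n arbitrary: g h)
  interpret UP: domain "poly_ring R"
    using univ_poly_is_domain[OF carrier_is_subring] .
  case 0
  then have "g \<in> Units (poly_ring R)"
    by (metis UP.Units_one_closed UP.nat_pow_0 UP.prod_unit_l UP.m_comm UP.unit_factor)
  then obtain k where "g = [k]" "k \<in> carrier R" using univ_poly_carrier_units by auto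
  then show ?case by simp
next
  interpret UP: domain "poly_ring R"
    using univ_poly_is_domain[OF carrier_is_subring] .
  case (Suc n)
  let ?L = "[\<one>, \<ominus> x]"
  have L: "?L \<in> carrier (poly_ring R)" using x unfolding sym[OF univ_poly_carrier] polynomial_def by auto
  have L0: "?L \<noteq> \<zero>\<^bsub>poly_ring R\<^esub>" by (simp add: univ_poly_zero)
  have Ln: "?L [^]\<^bsub>poly_ring R\<^esub> n \<in> carrier (poly_ring R)" using L by simp
  have evm: "eval (a \<otimes>\<^bsub>poly_ring R\<^esub> b) z = eval a z \<otimes> eval b z"
    if "a \<in> carrier (poly_ring R)" "b \<in> carrier (poly_ring R)" "z \<in> carrier R" for a b z
    using ring_hom_memE(2)[OF eval_is_hom[OF carrier_is_subring \<open>z \<in> _\<close>] that(1,2)] .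
  have evc: "eval a z \<in> carrier R" if "a \<in> carrier (poly_ring R)" "z \<in> carrier R" for a z
    using ring_hom_memE(1)[OF eval_is_hom[OF carrier_is_subring that(2)] that(1)] .
  have gh: "g \<otimes>\<^bsub>poly_ring R\<^esub> h = ?L \<otimes>\<^bsub>poly_ring R\<^esub> (?L [^]\<^bsub>poly_ring R\<^esub> n)"
    using Suc.prems(3) L by (simp add: UP.m_comm)
  have "?L [^]\<^bsub>poly_ring R\<^esub> Suc n \<noteq> \<zero>\<^bsub>poly_ring R\<^esub>"
    using polynomial_pow_not_zero[OF L, of "Suc n"] by (simp add: univ_poly_zero del: UP.nat_pow_Suc)
  then have nz: "g \<noteq> []" "h \<noteq> []"
    using Suc.prems L by (auto simp: univ_poly_zero[symmetric, of R "carrier R"])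
  have "eval g x \<otimes> eval h x = \<zero>"
  proof -
    have "eval g x \<otimes> eval h x = eval ?L x \<otimes> eval (?L [^]\<^bsub>poly_ring R\<^esub> n) x"
      using evm[OF Suc.prems(1,2) x] evm[OF L Ln x] gh by simp
    also have "eval ?L x = \<zero>" using x by (simp add: r_neg)
    finally show ?thesis using evc[OF Ln x] by simp
  qed
  then consider "eval g x = \<zero>" | "eval h x = \<zero>"
    using integral evc Suc.prems x by blast
  then show ?case
  proof cases
    case 1
    then have "?L pdivides g" using is_root_imp_pdivides[OF Suc.prems(1)] x nz by (simp add: is_root_def)
    then obtain g' where g': "g' \<in> carrier (poly_ring R)" "g = ?L \<otimes>\<^bsub>poly_ring R\<^esub> g'"
      unfolding pdivides_def factor_def by auto
    have "?L \<otimes>\<^bsub>poly_ring R\<^esub> (g' \<otimes>\<^bsub>poly_ring R\<^esub> h) = ?L \<otimes>\<^bsub>poly_ring R\<^esub> (?L [^]\<^bsub>poly_ring R\<^esub> n)"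
      using gh g' L Suc.prems(2) by (simp add: UP.m_assoc)
    then have "g' \<otimes>\<^bsub>poly_ring R\<^esub> h = ?L [^]\<^bsub>poly_ring R\<^esub> n"
      using UP.m_lcancel[OF L0 L] g' Suc.prems(2) Ln by simp
    then have IH: "eval g' \<zero> = lead_coeff g' \<otimes> (\<ominus> x) [^] degree g'"
      using Suc.IH g' Suc.prems(2) by blast
    have g'0: "g' \<noteq> []" using nz g' L by (metis UP.r_null univ_poly_zero)
    have pL: "polynomial (carrier R) ?L" and pg: "polynomial (carrier R) g'"
      using L g' by (auto simp: univ_poly_carrier)
    have lc: "lead_coeff g' \<in> carrier R"
      using pg g'0 by (auto simp: polynomial_def)
    have "degree g = Suc (degree g')"
      using poly_mult_degree_eq[OF carrier_is_subring pL pg] g' g'0 by (simp add: univ_poly_mult)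
    moreover have "lead_coeff g = lead_coeff g'"
      using poly_mult_lead_coeff[OF carrier_is_subring pL pg] g' g'0 lc by (simp add: univ_poly_mult)
    moreover have "eval g \<zero> = \<ominus> x \<otimes> eval g' \<zero>"
      using evm[OF L g'(1), of \<zero>] g' x by simp
    ultimately show ?thesis using IH lc x by (simp add: m_ac)
  next
    case 2
    then have "?L pdivides h" using is_root_imp_pdivides[OF Suc.prems(2)] x nz by (simp add: is_root_def)
    then obtain h' where h': "h' \<in> carrier (poly_ring R)" "h = ?L \<otimes>\<^bsub>poly_ring R\<^esub> h'"
      unfolding pdivides_def factor_def by auto
    have "?L \<otimes>\<^bsub>poly_ring R\<^esub> (g \<otimes>\<^bsub>poly_ring R\<^esub> h') = ?L \<otimes>\<^bsub>poly_ring R\<^esub> (?L [^]\<^bsub>poly_ring R\<^esub> n)"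
      using gh h' L Suc.prems(1) by (simp add: UP.m_lcomm)
    then have "g \<otimes>\<^bsub>poly_ring R\<^esub> h' = ?L [^]\<^bsub>poly_ring R\<^esub> n"
      using UP.m_lcancel[OF L0 L] h' Suc.prems(1) Ln by simp
    then show ?thesis using Suc.IH h' Suc.prems(1) by blast
  qed
qed

context positive_char_field begin

text \<open>\<open>(X - x)\<^sup>p = X\<^sup>p + (-x)\<^sup>p\<close> by the additivity of the Frobenius map of the polynomial ring. For
\<open>x \<noteq> \<zero>\<close> the constant \<open>(-x)\<^sup>p\<close> is the list with this one entry; \<open>\<zero>\<close> is the empty list.\<close>

lemma linear_power_coeffs:
  assumes N: "subfield N R" and x: "x \<in> carrier R" "x [^] p \<in> N" "x \<noteq> \<zero>"
  shows "[\<one>, \<ominus> x] [^]\<^bsub>poly_ring R\<^esub> p \<in> carrier (N[X])"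
proof -
  interpret UP: domain "poly_ring R"
    using univ_poly_is_domain[OF carrier_is_subring] .
  note sr = subringE[OF subfieldE(1)[OF N]]
  interpret H: ring_hom_ring R "poly_ring R" poly_of_const
    using canonical_embedding_ring_hom[OF carrier_is_subring] by simp
  have X: "X \<in> carrier (poly_ring R)" using var_closed[OF carrier_is_subring] by simp
  have c: "[\<ominus> x] \<in> carrier (poly_ring R)" and L: "[\<one>, \<ominus> x] = X \<oplus>\<^bsub>poly_ring R\<^esub> [\<ominus> x]"
    using x unfolding sym[OF univ_poly_carrier] polynomial_def univ_poly_add var_def by auto
  have pc: "poly_of_const a = [a]" if "a \<noteq> \<zero>" for a using that by (simp add: poly_of_const_def)
  have xp: "(\<ominus> x) [^] p \<noteq> \<zero>"
    using Units_pow_closed[of "\<ominus> x" p] x field_Units by auto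
  have "[p] \<cdot>\<^bsub>poly_ring R\<^esub> \<one>\<^bsub>poly_ring R\<^esub> = poly_of_const ([p] \<cdot> \<one>)"
  proof -
    have "poly_of_const ([n] \<cdot> \<one>) = [n] \<cdot>\<^bsub>poly_ring R\<^esub> \<one>\<^bsub>poly_ring R\<^esub>" for n :: nat
      by (induction n) auto
    then show ?thesis ..
  qed
  also have "\<dots> = \<zero>\<^bsub>poly_ring R\<^esub>" using char_dvd_iff[of p] by simp
  finally have "[\<one>, \<ominus> x] [^]\<^bsub>poly_ring R\<^esub> p
      = X [^]\<^bsub>poly_ring R\<^esub> p \<oplus>\<^bsub>poly_ring R\<^esub> [\<ominus> x] [^]\<^bsub>poly_ring R\<^esub> p"
    unfolding L using UP.frobenius_add[OF X c prime_char] by simp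
  also have "[\<ominus> x] [^]\<^bsub>poly_ring R\<^esub> p = [(\<ominus> x) [^] p]"
    using H.hom_nat_pow[of "\<ominus> x" p] x xp by (simp add: pc)
  also have "X [^]\<^bsub>poly_ring R\<^esub> p = monom \<one> p"
    using unitary_monom_eq_var_pow[OF carrier_is_subring] by simp
  finally have eq: "[\<one>, \<ominus> x] [^]\<^bsub>poly_ring R\<^esub> p = poly_add (monom \<one> p) [(\<ominus> x) [^] p]"
    by (simp add: univ_poly_add)
  have "\<ominus> x \<in> {x \<in> carrier R. x [^] (p ^ 1) \<in> N}"
    using subringE(5)[OF subfieldE(1)[OF subfield_frobenius_preimage[OF N, of 1]], of x] x by simp
  then have "polynomial N [(\<ominus> x) [^] p]" using xp by (auto simp: polynomial_def)
  moreover have "polynomial N (monom \<one> p)" using sr(3) by (intro monom_is_polynomial subfieldE(1)[OF N]) auto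
  ultimately show ?thesis
    unfolding eq univ_poly_carrier[symmetric] by (intro poly_add_closed subfieldE(1)[OF N])
qed

lemma linear_power_eval:
  assumes x: "x \<in> carrier R"
  shows "eval ([\<one>, \<ominus> x] [^]\<^bsub>poly_ring R\<^esub> p) x = \<zero>"
proof -
  interpret E: ring_hom_ring "poly_ring R" R "\<lambda>f. eval f x"
    using eval_ring_hom[OF carrier_is_subring x] .
  have L: "[\<one>, \<ominus> x] \<in> carrier (poly_ring R)"
    using x unfolding sym[OF univ_poly_carrier] polynomial_def by auto
  have "eval [\<one>, \<ominus> x] x = \<zero>" using x by (simp add: r_neg)
  then show ?thesis using E.hom_nat_pow[OF L, of p] char_pos by (simp add: nat_pow_zero)
qed

text \<open>The minimal polynomial of \<open>x\<close> over \<open>N\<close> divides \<open>(X - x)\<^sup>p\<close>, hence is \<open>(X - x)\<^sup>d\<close>, and its constant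
term puts \<open>x\<^sup>d\<close> into \<open>N\<close> up to sign. As \<open>x\<^sup>p \<in> N\<close> too, \<open>0 < d < p\<close> would give \<open>x \<in> N\<close> by a Bezout
identity for the exponents.\<close>

lemma degree_annihilator_ge:
  assumes N: "subfield N R" and x: "x \<in> carrier R" "x [^] p \<in> N" "x \<notin> N"
    and f: "f \<in> carrier (N[X])" "f \<noteq> []" "eval f x = \<zero>"
  shows "p \<le> degree f"
proof -
  note sr = subringE[OF subfieldE(1)[OF N]]
  have x0: "x \<noteq> \<zero>" using x sr(2) by auto
  let ?F = "[\<one>, \<ominus> x] [^]\<^bsub>poly_ring R\<^esub> p"
  have alg: "(algebraic over N) x" using algebraicI[OF f] .
  define g where "g = Irr N x"
  note g = IrrE[OF N x(1) alg, folded g_def]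
  have gR: "g \<in> carrier (poly_ring R)" using carrier_polynomial_shell[OF subfieldE(1)[OF N] g(1)] .
  have "g pdivides ?F"
    using Irr_minimal[OF N x(1) alg linear_power_coeffs[OF N x(1,2) x0] linear_power_eval[OF x(1)]]
    by (simp add: g_def)
  then obtain h where h: "h \<in> carrier (poly_ring R)" "g \<otimes>\<^bsub>poly_ring R\<^esub> h = ?F"
    unfolding pdivides_def factor_def by auto
  define d where "d = degree g"
  define y where "y = \<ominus> x"
  have "eval g \<zero> = y [^] d"
    using eval_zero_divisor_linear_power[OF x(1) gR h] g(3) x by (simp add: d_def y_def)
  moreover have "eval g \<zero> \<in> simple_extension N \<zero>"
    using simple_extension_as_eval_img[OF sr(1) zero_closed] g(1) by auto
  moreover have "simple_extension N \<zero> \<subseteq> N"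
    using simple_extension_subring_incl[OF subfieldE(1)[OF N] subset_refl sr(2)] .
  ultimately have yd: "y [^] d \<in> N" by auto
  have y: "y \<in> carrier R" "y \<noteq> \<zero>" "y \<notin> N"
    using x x0 sr(5)[of y] by (auto simp: y_def)
  have yp: "y [^] p \<in> N"
    using subringE(5)[OF subfieldE(1)[OF subfield_frobenius_preimage[OF N, of 1]], of x] x
    by (simp add: y_def)
  have d1: "1 \<le> d" using pirreducible_degree[OF N g(1,2)] by (simp add: d_def)
  note pw = subfield_pow_closed[OF N]
  have "p \<le> d"
  proof (rule ccontr)
    assume "\<not> p \<le> d"
    then have "coprime d p"
      using prime_char d1 by (metis coprime_commute dvd_imp_le le_zero_eq not_one_le_zero prime_imp_coprime_nat gr0I)
    then obtain u v where uv: "d * u = p * v + 1"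
      using bezout_nat[of d p] d1 by auto
    define a where "a = (y [^] p) [^] v"
    have a: "a \<in> N" unfolding a_def by (rule pw[OF yp])
    have "a \<in> Units R" unfolding a_def using y field_Units by (intro Units_pow_closed) auto
    then have au: "a \<in> carrier R" "a \<noteq> \<zero>" "inv a \<in> carrier R" "inv a \<otimes> a = \<one>" using field_Units by auto
    have "(y [^] d) [^] u = a \<otimes> y"
      using y by (simp add: a_def nat_pow_pow uv)
    then have "a \<otimes> y \<in> N" using pw[OF yd, of u] by simp
    moreover have "inv a \<in> N" using subfield_m_inv[OF N] a au by blast
    ultimately have "inv a \<otimes> (a \<otimes> y) \<in> N" using sr(6) by blast
    moreover have "inv a \<otimes> (a \<otimes> y) = y" using au y by (simp add: m_assoc[symmetric])
    ultimately show False using y by simp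
  qed
  also have "d \<le> degree f"
    using pdivides_imp_degree_le[OF subfieldE(1)[OF N] g(1) f(1,2)] Irr_minimal[OF N x(1) alg f(1,3)]
    by (simp add: d_def g_def)
  finally show ?thesis .
qed


text \<open>Write \<open>b = r(x)\<close> with \<open>r\<close> over \<open>M\<close> of degree less than \<open>p\<close>. Then \<open>r - b\<close> is a polynomial over \<open>M(b)\<close>
of degree less than \<open>p\<close> that vanishes at \<open>x\<close>. If \<open>x\<close> were not in \<open>M(b)\<close>, it would be the zero
polynomial, so that \<open>b\<close> would be a coefficient of \<open>r\<close> and thus in \<open>M\<close>.\<close>

lemma adjoin_exchange:
  assumes M: "subfield M R" and x: "x \<in> carrier R" "x [^] p \<in> M"
    and b: "b \<in> adjoin R M {x}" "b \<notin> M"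
  shows "x \<in> adjoin R M {b}"
proof (rule ccontr)
  note sr = subringE[OF subfieldE(1)[OF M]]
  let ?F = "[\<one>, \<ominus> x] [^]\<^bsub>poly_ring R\<^esub> p"
  define N where "N = adjoin R M {b}"
  assume "x \<notin> adjoin R M {b}"
  then have xN: "x \<notin> N" by (simp add: N_def)
  have bR: "b \<in> carrier R"
    using b(1) generate_field_incl[of "M \<union> {x}"] sr(1) x(1) unfolding adjoin_def by auto
  have MbR: "M \<union> {b} \<subseteq> carrier R" using sr(1) bR by auto
  have N: "subfield N R" unfolding N_def adjoin_def by (rule generate_field_is_subfield[OF MbR])
  have MN: "M \<subseteq> N" "b \<in> N" unfolding N_def adjoin_def by (auto intro: generate_field.incl)
  note srN = subringE[OF subfieldE(1)[OF N]]
  have x0: "x \<noteq> \<zero>" "x \<notin> M" using xN MN srN(2) by auto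
  have L: "[\<one>, \<ominus> x] \<in> carrier (poly_ring R)"
    using x unfolding sym[OF univ_poly_carrier] polynomial_def by auto
  have F: "?F \<in> carrier (M[X])" by (rule linear_power_coeffs[OF M x x0(1)])
  have F0: "?F \<noteq> []" by (rule polynomial_pow_not_zero[OF L]) simp
  have dF: "degree ?F = p" using polynomial_pow_degree[OF L, of p] by simp
  have "(algebraic over M) x"
    using algebraicI[OF F F0 linear_power_eval[OF x(1)]] .
  then have "subfield (simple_extension M x) R"
    using simple_extension_is_subfield[OF M x(1)] by simp
  then have "adjoin R M {x} \<subseteq> simple_extension M x"
    unfolding adjoin_def
    using generate_field_min_subfield1[of "M \<union> {x}"] simple_extension_incl[OF sr(1) x(1)]
      simple_extension_mem[OF subfieldE(1)[OF M] x(1)] sr(1) x(1) by simp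
  then obtain f where f: "f \<in> carrier (M[X])" "b = eval f x"
    using b(1) simple_extension_as_eval_img[OF sr(1) x(1)] by auto
  obtain q r where qr: "q \<in> carrier (M[X])" "r \<in> carrier (M[X])"
      "f = (?F \<otimes>\<^bsub>M[X]\<^esub> q) \<oplus>\<^bsub>M[X]\<^esub> r" "r = [] \<or> degree r < p"
    using subfield_long_division_theorem_shell[OF M f(1) F] F0 dF by (auto simp: univ_poly_zero)
  have br: "b = eval r x"
  proof -
    interpret E: ring_hom_ring "M[X]" R "\<lambda>f. eval f x"
      using eval_ring_hom[OF subfieldE(1)[OF M] x(1)] .
    have "b = \<zero> \<otimes> eval q x \<oplus> eval r x"
      unfolding f(2) qr(3) using qr(1,2) F linear_power_eval[OF x(1)] by simp
    then show ?thesis using E.hom_closed qr(1,2) by simp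
  qed
  have b0: "b \<noteq> \<zero>" using b(2) sr(2) by auto
  have rN: "r \<in> carrier (N[X])" and cN: "[\<ominus> b] \<in> carrier (N[X])"
    using qr(2) MN b0 bR srN(5)[of b] unfolding sym[OF univ_poly_carrier] polynomial_def by auto
  define s where "s = poly_add r [\<ominus> b]"
  interpret EN: ring_hom_ring "N[X]" R "\<lambda>f. eval f x"
    using eval_ring_hom[OF subfieldE(1)[OF N] x(1)] .
  have s: "s \<in> carrier (N[X])" "eval s x = \<zero>"
  proof -
    show "s \<in> carrier (N[X])" using EN.R.a_closed[OF rN cN] by (simp add: s_def univ_poly_add)
    have "eval s x = eval r x \<oplus> eval [\<ominus> b] x"
      using EN.hom_add[OF rN cN] by (simp add: s_def univ_poly_add)
    then show "eval s x = \<zero>" using br bR by (simp add: r_neg)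
  qed
  have "degree s < p"
    using poly_add_degree[of r "[\<ominus> b]"] qr(4) char_pos by (auto simp: s_def)
  then have "s = []"
    using degree_annihilator_ge[OF N x(1) _ xN s(1) _ s(2)] x(2) MN(1) by fastforce
  then have "r \<oplus>\<^bsub>N[X]\<^esub> [\<ominus> b] = \<zero>\<^bsub>N[X]\<^esub>" by (simp add: s_def univ_poly_add univ_poly_zero)
  then have "r = \<ominus>\<^bsub>N[X]\<^esub> [\<ominus> b]" using EN.R.minus_equality[OF _ cN rN] by simp
  also have "\<dots> = [b]" using univ_poly_a_inv_def'[OF subfieldE(1)[OF N] cN] bR by simp
  finally have "b \<in> M" using qr(2) unfolding sym[OF univ_poly_carrier] polynomial_def by auto
  then show False using b(2) by simp
qed

section \<open>Generation by adjoining\<close>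

lemma adjoin_base: "k \<subseteq> adjoin R k S" and adjoin_gens: "S \<subseteq> adjoin R k S"
  by (auto simp: adjoin_def intro: generate_field.incl)

lemma adjoin_subfield: "k \<subseteq> carrier R \<Longrightarrow> S \<subseteq> carrier R \<Longrightarrow> subfield (adjoin R k S) R"
  unfolding adjoin_def by (rule generate_field_is_subfield) simp

lemma adjoin_carrier: "k \<subseteq> carrier R \<Longrightarrow> S \<subseteq> carrier R \<Longrightarrow> adjoin R k S \<subseteq> carrier R"
  unfolding adjoin_def by (rule generate_field_incl) simp

lemma adjoin_least: "subfield E R \<Longrightarrow> k \<subseteq> E \<Longrightarrow> S \<subseteq> E \<Longrightarrow> adjoin R k S \<subseteq> E"
  unfolding adjoin_def by (rule generate_field_min_subfield1) (auto dest: subfieldE(3))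

lemma adjoin_mono:
  "k \<subseteq> k' \<Longrightarrow> S \<subseteq> S' \<Longrightarrow> k' \<subseteq> carrier R \<Longrightarrow> S' \<subseteq> carrier R \<Longrightarrow> adjoin R k S \<subseteq> adjoin R k' S'"
  unfolding adjoin_def by (rule mono_generate_field) auto

lemma adjoin_adjoin:
  assumes "k \<subseteq> carrier R" "S \<subseteq> carrier R" "T \<subseteq> carrier R"
  shows "adjoin R (adjoin R k S) T = adjoin R k (S \<union> T)"
proof
  show "adjoin R (adjoin R k S) T \<subseteq> adjoin R k (S \<union> T)"
    using assms adjoin_base[of k "S \<union> T"] adjoin_gens[of "S \<union> T" k] 
    by (intro adjoin_least adjoin_subfield) auto
  show "adjoin R k (S \<union> T) \<subseteq> adjoin R (adjoin R k S) T"
    using assms adjoin_base[of k S] adjoin_gens[of S k] adjoin_base[of "adjoin R k S" T]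
      adjoin_gens[of T "adjoin R k S"] adjoin_carrier[of k S]
    by (intro adjoin_least[OF adjoin_subfield[of "adjoin R k S"]]) auto
qed

lemma adjoin_finitary:
  assumes "x \<in> adjoin R k S" "k \<subseteq> carrier R" "S \<subseteq> carrier R"
  obtains F where "finite F" "F \<subseteq> S" "x \<in> adjoin R k F"
proof -
  have mono: "h \<in> generate_field R (k \<union> F')"
    if "h \<in> generate_field R (k \<union> F)" "F \<subseteq> F'" "F' \<subseteq> S" for h F F'
    using that mono_generate_field[of "k \<union> F" "k \<union> F'"] assms(2,3) by blast
  have "\<exists>F. finite F \<and> F \<subseteq> S \<and> x \<in> generate_field R (k \<union> F)"
    using assms(1) unfolding adjoin_def
  proof (induction rule: generate_field.induct)
    case one
    then show ?case using generate_field.one by blast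
  next
    case (incl h)
    then have "h \<in> generate_field R (k \<union> ({h} \<inter> S))" by (intro generate_field.incl) auto
    then show ?case by (intro exI[of _ "{h} \<inter> S"]) auto
  next
    case (a_inv h)
    then obtain F where "finite F" "F \<subseteq> S" "h \<in> generate_field R (k \<union> F)" by blast
    then show ?case using a_inv.hyps by (intro exI[of _ F]) (auto intro: generate_field.a_inv)
  next
    case (m_inv h)
    then obtain F where "finite F" "F \<subseteq> S" "h \<in> generate_field R (k \<union> F)" by blast
    then show ?case using m_inv.hyps by (intro exI[of _ F]) (auto intro: generate_field.m_inv)
  next
    case (eng_add h1 h2)
    then obtain F1 F2 where F: "finite F1" "F1 \<subseteq> S" "h1 \<in> generate_field R (k \<union> F1)"
      "finite F2" "F2 \<subseteq> S" "h2 \<in> generate_field R (k \<union> F2)" by blast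
    then have "h1 \<in> generate_field R (k \<union> (F1 \<union> F2))" "h2 \<in> generate_field R (k \<union> (F1 \<union> F2))"
      by (auto intro: mono)
    then show ?case using F by (intro exI[of _ "F1 \<union> F2"]) (auto intro: generate_field.eng_add)
  next
    case (eng_mult h1 h2)
    then obtain F1 F2 where F: "finite F1" "F1 \<subseteq> S" "h1 \<in> generate_field R (k \<union> F1)"
      "finite F2" "F2 \<subseteq> S" "h2 \<in> generate_field R (k \<union> F2)" by blast
    then have "h1 \<in> generate_field R (k \<union> (F1 \<union> F2))" "h2 \<in> generate_field R (k \<union> (F1 \<union> F2))"
      by (auto intro: mono)
    then show ?case using F by (intro exI[of _ "F1 \<union> F2"]) (auto intro: generate_field.eng_mult)
  qed
  then show thesis using that unfolding adjoin_def by blast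
qed

section \<open>p-independent sets\<close>

text \<open>Unlike p-independence in the usual sense, which is relative to a field containing all \<open>p\<close>-th
powers, the base \<open>M\<close> need only contain the \<open>p\<close>-th powers of the members. This lets \<open>M\<close> and the
ambient field vary independently.\<close>

definition p_independent :: "'a set \<Rightarrow> 'a set \<Rightarrow> bool" where
  "p_independent M C \<longleftrightarrow> C \<subseteq> carrier R \<and> (\<forall>x\<in>C. x [^] p \<in> M \<and> x \<notin> adjoin R M (C - {x}))"

lemma p_independent_antimono:
  assumes "p_independent M C" "M' \<subseteq> M" "C' \<subseteq> C" "M \<subseteq> carrier R" "\<And>x. x \<in> C' \<Longrightarrow> x [^] p \<in> M'"
  shows "p_independent M' C'"
proof -
  have "adjoin R M' (C' - {x}) \<subseteq> adjoin R M (C - {x})" for x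
    using assms by (intro adjoin_mono) (auto simp: p_independent_def)
  then show ?thesis using assms unfolding p_independent_def by blast
qed

lemma exchange_set:
  assumes "M \<subseteq> carrier R" "S \<subseteq> carrier R" "x \<in> carrier R" "x [^] p \<in> M"
    and "b \<in> adjoin R M (insert x S)" "b \<notin> adjoin R M S"
  shows "x \<in> adjoin R M (insert b S)"
proof -
  have eq: "adjoin R (adjoin R M S) {y} = adjoin R M (insert y S)" if "y \<in> carrier R" for y
    using adjoin_adjoin[of M S "{y}"] assms that by simp
  have "b \<in> carrier R" using adjoin_carrier[of M "insert x S"] assms by auto
  moreover have "x [^] p \<in> adjoin R M S" using adjoin_base assms(4) by blast
  ultimately show ?thesis
    using adjoin_exchange[of "adjoin R M S" x b] eq adjoin_subfield assms by metis
qed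

lemma p_independent_insert:
  assumes M: "M \<subseteq> carrier R" and C: "p_independent M C"
    and x: "x \<in> carrier R" "x [^] p \<in> M" "x \<notin> adjoin R M C"
  shows "p_independent M (insert x C)" "x \<notin> C"
proof -
  show xC: "x \<notin> C" using x(3) adjoin_gens by blast
  have CR: "C \<subseteq> carrier R" using C by (simp add: p_independent_def)
  have "c \<notin> adjoin R M (insert x C - {c})" if c: "c \<in> C" for c
  proof
    assume "c \<in> adjoin R M (insert x C - {c})"
    moreover have "insert x C - {c} = insert x (C - {c})" using xC c by auto
    moreover have "c \<notin> adjoin R M (C - {c})" using C c by (simp add: p_independent_def)
    ultimately have "x \<in> adjoin R M (insert c (C - {c}))"
      using exchange_set[of M "C - {c}" x c] M CR x by auto
    then show False using c x(3) by (simp add: insert_absorb)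
  qed
  then show "p_independent M (insert x C)"
    using C x xC by (auto simp: p_independent_def)
qed

text \<open>Enlarging the base by \<open>y\<close> costs at most one member. If \<open>C\<close> becomes dependent, some \<open>c\<close> is generated
by \<open>y\<close> and the others; a further dependency would by exchange put \<open>y\<close> into the field generated by
\<open>C - {c}\<close>, and then \<open>c\<close> as well.\<close>

lemma p_independent_contract:
  assumes M: "M \<subseteq> carrier R" and C: "p_independent M C" and fin: "finite C"
    and y: "y \<in> carrier R" "y [^] p \<in> M"
  obtains C' where "C' \<subseteq> C" "card C \<le> Suc (card C')" "p_independent (adjoin R M {y}) C'"
proof (cases "p_independent (adjoin R M {y}) C")
  case True
  then show thesis using that[of C] by simp
next
  case False
  have CR: "C \<subseteq> carrier R" using C by (simp add: p_independent_def)
  have ad: "adjoin R (adjoin R M {y}) S = adjoin R M (insert y S)" if "S \<subseteq> C" for S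
    using adjoin_adjoin[of M "{y}" S] M y that CR by auto
  have pw: "c [^] p \<in> adjoin R M {y}" if "c \<in> C" for c
    using C that adjoin_base[of M "{y}"] by (auto simp: p_independent_def)
  obtain c where c: "c \<in> C" "c \<in> adjoin R M (insert y (C - {c}))"
    using False CR pw ad by (auto simp: p_independent_def)
  let ?C = "C - {c}"
  have cn: "c \<notin> adjoin R M ?C" using C c by (simp add: p_independent_def)
  have "d \<notin> adjoin R M (insert y (?C - {d}))" if d: "d \<in> ?C" for d
  proof
    assume d': "d \<in> adjoin R M (insert y (?C - {d}))"
    have "adjoin R M (?C - {d}) \<subseteq> adjoin R M (C - {d})"
      using M CR by (intro adjoin_mono) auto
    then have "d \<notin> adjoin R M (?C - {d})" using C d by (auto simp: p_independent_def)
    then have "y \<in> adjoin R M (insert d (?C - {d}))"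
      using exchange_set[of M "?C - {d}" y d] d' M CR y by auto
    then have "y \<in> adjoin R M ?C" using d by (simp add: insert_absorb)
    then have "adjoin R M (insert y ?C) \<subseteq> adjoin R M ?C"
      using adjoin_base[of M ?C] adjoin_gens[of ?C M] M CR by (intro adjoin_least adjoin_subfield) auto
    then show False using c cn by blast
  qed
  then have "p_independent (adjoin R M {y}) ?C"
    unfolding p_independent_def using CR pw by (auto simp: ad subset_iff)
  then show thesis using that[of ?C] c fin by (auto simp: card_Diff_singleton)
qed

text \<open>The Steinitz bound: pass from \<open>M\<close> to \<open>M(F)\<close> one generator at a time, losing at most one member of \<open>C\<close>
each time; over \<open>M(F)\<close> no member can be left.\<close>

lemma p_independent_card_le:
  assumes "finite F" "M \<subseteq> carrier R" "p_independent M C" "finite C" "C \<subseteq> adjoin R M F"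
    "F \<subseteq> carrier R" "\<And>x. x \<in> F \<Longrightarrow> x [^] p \<in> M"
  shows "card C \<le> card F"
  using assms
proof (induction F arbitrary: M C rule: finite_induct)
  case empty
  have "C = {}"
  proof (rule ccontr)
    assume "C \<noteq> {}"
    then obtain c where c: "c \<in> C" by blast
    have "adjoin R M {} \<subseteq> adjoin R M (C - {c})"
      using empty by (intro adjoin_mono) (auto simp: p_independent_def)
    then show False using c empty by (auto simp: p_independent_def)
  qed
  then show ?case by simp
next
  case (insert y F)
  obtain C' where C': "C' \<subseteq> C" "card C \<le> Suc (card C')" "p_independent (adjoin R M {y}) C'"
    using p_independent_contract[OF insert.prems(1,2,3), of y] insert.prems by auto
  have "card C' \<le> card F"
  proof (rule insert.IH)
    show "adjoin R M {y} \<subseteq> carrier R" using insert.prems by (intro adjoin_carrier) auto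
    show "C' \<subseteq> adjoin R (adjoin R M {y}) F"
      using adjoin_adjoin[of M "{y}" F] insert.prems C' by auto
    show "finite C'" using C' insert.prems finite_subset by blast
  qed (use C' insert.prems adjoin_base[of M "{y}"] in auto)
  then show ?case using C' insert by simp
qed

section \<open>p-independence along a tower\<close>

text \<open>The field \<open>k(L\<^sup>p)\<close>: the r-bases of \<open>L/k\<close> are the subsets of \<open>L\<close> that generate \<open>L\<close> over it and are
p-independent over it.\<close>

abbreviation adjoin_powers :: "'a set \<Rightarrow> 'a set \<Rightarrow> 'a set" where
  "adjoin_powers k L \<equiv> adjoin R k (char_powers R L)"

lemma char_powers_carrier: "L \<subseteq> carrier R \<Longrightarrow> char_powers R L \<subseteq> carrier R"
  by (auto simp: char_powers_def)

lemma char_powers_subset: "subfield L R \<Longrightarrow> char_powers R L \<subseteq> L"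
  by (auto simp: char_powers_def subfield_pow_closed)

text \<open>With \<open>A = k(L\<^sup>p)\<close> and \<open>y = x\<^sup>p\<close>, the new base is \<open>k(L(x)\<^sup>p) = A(y)\<close>. At most one member of \<open>C\<close> is lost
in passing to \<open>A(y)\<close>, and \<open>x\<close> can be added to the others, since together with \<open>A(y)\<close> they generate
a subfield of \<open>L\<close>, and \<open>x\<close> may be assumed not to lie in \<open>L\<close>.\<close>

lemma p_independent_step:
  assumes k: "k \<subseteq> L" and L: "subfield L R" and x: "x \<in> carrier R" "x [^] p \<in> L"
    and C: "C \<subseteq> L" "finite C" "p_independent (adjoin_powers k L) C"
  obtains C' where "C' \<subseteq> adjoin R L {x}" "finite C'" "card C \<le> card C'"
    "p_independent (adjoin_powers k (adjoin R L {x})) C'"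
proof (cases "x \<in> L")
  case True
  then have "adjoin R L {x} = L"
    using adjoin_least[OF L, of L "{x}"] adjoin_base[of L "{x}"] by auto
  then show thesis using that[of C] C by simp
next
  case False
  define A where "A = adjoin_powers k L"
  define y where "y = x [^] p"
  define L' where "L' = adjoin R L {x}"
  have LR: "L \<subseteq> carrier R" using L by (rule subfieldE(3))
  have kR: "k \<subseteq> carrier R" using k LR by simp
  have y: "y \<in> L" "y \<in> carrier R" using x LR by (auto simp: y_def)
  have AL: "A \<subseteq> L"
    unfolding A_def using k char_powers_subset[OF L] by (intro adjoin_least L)
  have AR: "A \<subseteq> carrier R" using AL LR by simp
  have pow: "z [^] p \<in> A" if "z \<in> L" for z
    using that adjoin_gens[of "char_powers R L" k] by (auto simp: A_def char_powers_def)
  have L'R: "L' \<subseteq> carrier R" unfolding L'_def using LR x by (intro adjoin_carrier) auto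
  \<comment> \<open>Frobenius maps \<open>L(x)\<close> into \<open>A(y)\<close>, because it does so on \<open>L\<close> and on \<open>x\<close>.\<close>
  have Ay: "adjoin_powers k L' = adjoin R A {y}"
  proof
    have Ayf: "subfield (adjoin R A {y}) R" using AR y by (intro adjoin_subfield) auto
    have "L' \<subseteq> {z \<in> carrier R. z [^] (p ^ 1) \<in> adjoin R A {y}}"
      unfolding L'_def
      using pow LR x adjoin_base[of A "{y}"] adjoin_gens[of "{y}" A]
      by (intro adjoin_least subfield_frobenius_preimage Ayf) (auto simp: y_def)
    then have "char_powers R L' \<subseteq> adjoin R A {y}" by (auto simp: char_powers_def)
    moreover have "k \<subseteq> adjoin R A {y}"
      using adjoin_base[of A "{y}"] adjoin_base[of k "char_powers R L"] by (auto simp: A_def)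
    ultimately show "adjoin_powers k L' \<subseteq> adjoin R A {y}" by (intro adjoin_least Ayf)
    have "A \<subseteq> adjoin_powers k L'" unfolding A_def
      using adjoin_base[of L "{x}"] L'R kR
      by (intro adjoin_mono char_powers_carrier) (auto simp: L'_def char_powers_def)
    moreover have "y \<in> adjoin_powers k L'"
      using adjoin_gens[of "char_powers R L'" k] adjoin_gens[of "{x}" L]
      by (auto simp: L'_def char_powers_def y_def)
    ultimately show "adjoin R A {y} \<subseteq> adjoin_powers k L'"
      using L'R kR by (intro adjoin_least adjoin_subfield char_powers_carrier) auto
  qed
  obtain C' where C': "C' \<subseteq> C" "card C \<le> Suc (card C')" "p_independent (adjoin R A {y}) C'"
    using p_independent_contract[OF AR C(3)[folded A_def] C(2) y(2) pow[OF y(1)]] .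
  have "adjoin R (adjoin R A {y}) C' \<subseteq> L"
    using AL y C' C by (intro adjoin_least L) auto
  then have xn: "x \<notin> adjoin R (adjoin R A {y}) C'" using False by blast
  have xp: "x [^] p \<in> adjoin R A {y}" using adjoin_gens[of "{y}" A] by (simp add: y_def)
  have AyR: "adjoin R A {y} \<subseteq> carrier R" using AR y by (intro adjoin_carrier) auto
  note ins = p_independent_insert[OF AyR C'(3) x(1) xp xn]
  have fC': "finite C'" using C' C finite_subset by blast
  show thesis
  proof (rule that[of "insert x C'"])
    show "insert x C' \<subseteq> adjoin R L {x}"
      using C' C adjoin_base[of L "{x}"] adjoin_gens[of "{x}" L] by auto
    show "card C \<le> card (insert x C')" using C' fC' ins(2) by simp
    show "p_independent (adjoin_powers k (adjoin R L {x})) (insert x C')"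
      using ins(1) Ay by (simp add: L'_def)
  qed (use fC' in simp)
qed

lemma p_independent_step_pow:
  assumes k: "k \<subseteq> L" and L: "subfield L R" and x: "x \<in> carrier R" "x [^] (p ^ n) \<in> L"
    and C: "C \<subseteq> L" "finite C" "p_independent (adjoin_powers k L) C"
  shows "\<exists>C'\<subseteq>adjoin R L {x}. finite C' \<and> card C \<le> card C' \<and> 
    p_independent (adjoin_powers k (adjoin R L {x})) C'"
  using x
proof (induction n arbitrary: x)
  case 0
  then have "adjoin R L {x} = L"
    using adjoin_least[OF L, of L "{x}"] adjoin_base[of L "{x}"] by auto
  then show ?case using C by auto
next
  case (Suc n)
  let ?y = "x [^] p"
  let ?L = "adjoin R L {?y}"
  have LR: "L \<subseteq> carrier R" using L by (rule subfieldE(3))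
  have yR: "?y \<in> carrier R" using Suc.prems by simp
  moreover have "?y [^] (p ^ n) \<in> L" using Suc.prems by (simp add: nat_pow_pow)
  ultimately obtain C1 where C1: "C1 \<subseteq> ?L" "finite C1" "card C \<le> card C1" "p_independent (adjoin_powers k ?L) C1"
    using Suc.IH by blast
  have "k \<subseteq> ?L" using k adjoin_base[of L "{?y}"] by auto
  moreover have "?y \<in> ?L" using adjoin_gens[of "{?y}" L] by auto
  moreover have "subfield ?L R" using LR yR by (intro adjoin_subfield) auto
  ultimately obtain C2 where C2: "C2 \<subseteq> adjoin R ?L {x}" "finite C2" "card C1 \<le> card C2"
    "p_independent (adjoin_powers k (adjoin R ?L {x})) C2"
    using p_independent_step[of k ?L x C1] C1 Suc.prems by metis
  have Lx: "subfield (adjoin R L {x}) R" using LR Suc.prems by (intro adjoin_subfield) auto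
  have "x \<in> adjoin R L {x}" using adjoin_gens[of "{x}" L] by auto
  then have "?y \<in> adjoin R L {x}" using char_powers_subset[OF Lx] by (auto simp: char_powers_def)
  then have "adjoin R L ({?y} \<union> {x}) = adjoin R L {x}"
    using adjoin_least[OF Lx, of L "{?y} \<union> {x}"] adjoin_base[of L "{x}"] adjoin_gens[of "{x}" L]
      adjoin_mono[of L L "{x}" "{?y} \<union> {x}"] LR Suc.prems yR by auto
  then have "adjoin R ?L {x} = adjoin R L {x}"
    using adjoin_adjoin[of L "{?y}" "{x}"] LR yR Suc.prems by simp
  then show ?case using C2 C1(3) by (auto intro!: exI[of _ C2])
qed

lemma p_independent_extend:
  assumes "finite F" and k: "k \<subseteq> L" and L: "subfield L R"
    and C: "C \<subseteq> L" "finite C" "p_independent (adjoin_powers k L) C"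
    and F: "F \<subseteq> carrier R" "\<And>x. x \<in> F \<Longrightarrow> \<exists>n. x [^] (p ^ n) \<in> k"
  shows "\<exists>C'\<subseteq>adjoin R L F. finite C' \<and> card C \<le> card C' \<and> 
    p_independent (adjoin_powers k (adjoin R L F)) C'"
  using assms(1) F
proof (induction F rule: finite_induct)
  case empty
  have "adjoin R L {} = L" using adjoin_least[OF L, of L "{}"] adjoin_base[of L "{}"] by auto
  then show ?case using C by auto
next
  case (insert x F)
  let ?L = "adjoin R L F"
  have LR: "L \<subseteq> carrier R" using L by (rule subfieldE(3))
  obtain C1 where C1: "C1 \<subseteq> ?L" "finite C1" "card C \<le> card C1" "p_independent (adjoin_powers k ?L) C1"
    using insert by auto
  have k': "k \<subseteq> ?L" using k adjoin_base[of L F] by auto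
  obtain n where "x [^] (p ^ n) \<in> k" using insert.prems(2)[of x] by auto
  then have "x [^] (p ^ n) \<in> ?L" using k' by auto
  then obtain C2 where C2: "C2 \<subseteq> adjoin R ?L {x}" "finite C2" "card C1 \<le> card C2"
    "p_independent (adjoin_powers k (adjoin R ?L {x})) C2"
    using p_independent_step_pow[OF k' adjoin_subfield[OF LR] _ _ C1(1,2,4), of x n] insert.prems by auto
  have "adjoin R ?L {x} = adjoin R L (insert x F)"
    using adjoin_adjoin[of L F "{x}"] LR insert.prems by simp
  then show ?case using C2 C1(3) by (auto intro!: exI[of _ C2])
qed

text \<open>Start from the subfield \<open>L\<^sub>0 = k(C)\<close> of \<open>L\<close>: as \<open>k(L\<^sub>0\<^sup>p) \<subseteq> k(L\<^sup>p)\<close>, the set \<open>C\<close> stays independent, and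
unlike \<open>L\<close> this field is contained in \<open>k(F)\<close>. Adjoining \<open>F\<close> to it yields \<open>E = k(F)\<close> and an independent set over \<open>k(E\<^sup>p)\<close> that is no
smaller, and this set is bounded by the generating set \<open>F\<close>.\<close>

lemma p_independent_finite_bound:
  assumes k: "k \<subseteq> L" and L: "subfield L R"
    and C: "C \<subseteq> L" "finite C" "p_independent (adjoin_powers k L) C"
    and F: "finite F" "F \<subseteq> carrier R" "\<And>x. x \<in> F \<Longrightarrow> \<exists>n. x [^] (p ^ n) \<in> k"
    and CF: "C \<subseteq> adjoin R k F"
  shows "card C \<le> card F"
proof -
  define L0 where "L0 = adjoin R k C"
  define E where "E = adjoin R k F"
  have LR: "L \<subseteq> carrier R" using L by (rule subfieldE(3))
  have kR: "k \<subseteq> carrier R" and CR: "C \<subseteq> carrier R" using k C LR by auto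
  have L0: "subfield L0 R" "k \<subseteq> L0" "C \<subseteq> L0" "L0 \<subseteq> L"
    using kR CR adjoin_base[of k C] adjoin_gens[of C k] k C
    by (auto simp: L0_def intro: adjoin_subfield dest: adjoin_least[OF L, of k C])
  have "p_independent (adjoin_powers k L0) C"
  proof (rule p_independent_antimono[OF C(3) _ subset_refl])
    show "adjoin_powers k L0 \<subseteq> adjoin_powers k L" 
      using L0(4) kR LR by (intro adjoin_mono char_powers_carrier) (auto simp: char_powers_def)
    show "adjoin_powers k L \<subseteq> carrier R" by (intro adjoin_carrier kR char_powers_carrier LR)
    show "x [^] p \<in> adjoin_powers k L0" if "x \<in> C" for x
      using that L0(3) adjoin_gens[of "char_powers R L0" k] by (auto simp: char_powers_def)
  qed
  from p_independent_extend[OF F(1) L0(2,1,3) C(2) this F(2,3)]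
  obtain C' where C': "C' \<subseteq> adjoin R L0 F" "finite C'" "card C \<le> card C'"
    "p_independent (adjoin_powers k (adjoin R L0 F)) C'" by blast
  have E: "subfield E R" unfolding E_def by (intro adjoin_subfield kR F)
  have eq: "adjoin R L0 F = E"
  proof
    show "adjoin R L0 F \<subseteq> E"
      using adjoin_least[OF E, of k C] CF adjoin_base[of k F] adjoin_gens[of F k]
      by (intro adjoin_least E) (auto simp: L0_def E_def)
    show "E \<subseteq> adjoin R L0 F"
      unfolding E_def using L0 F L by (intro adjoin_mono) (auto dest: subfieldE(3))
  qed
  have ER: "E \<subseteq> carrier R" using E by (rule subfieldE(3))
  have "card C' \<le> card F"
  proof (rule p_independent_card_le)
    show "C' \<subseteq> adjoin R (adjoin_powers k E) F"
      using C'(1) eq adjoin_mono[of k "adjoin_powers k E" F F] adjoin_base[of k "char_powers R E"] F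
        adjoin_carrier[OF kR char_powers_carrier[OF ER]] by (auto simp: E_def)
    show "adjoin_powers k E \<subseteq> carrier R" by (intro adjoin_carrier kR char_powers_carrier ER)
    show "x [^] p \<in> adjoin_powers k E" if "x \<in> F" for x
      using that adjoin_gens[of "char_powers R E" k] adjoin_gens[of F k] by (auto simp: char_powers_def E_def)
  qed (use F C' eq in auto)
  then show ?thesis using C'(3) by simp
qed

section \<open>r-bases\<close>

lemma adjoin_powers_subset: "subfield K R \<Longrightarrow> k \<subseteq> K \<Longrightarrow> adjoin_powers k K \<subseteq> K"
  using char_powers_subset by (intro adjoin_least) auto

lemma pow_in_adjoin_powers: "x \<in> K \<Longrightarrow> x [^] p \<in> adjoin_powers k K"
  using adjoin_gens[of "char_powers R K" k] by (auto simp: char_powers_def)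

lemma r_base_iff_p_independent:
  assumes "subfield K R"
  shows "r_base R K k B \<longleftrightarrow> B \<subseteq> K \<and> K = adjoin R (adjoin_powers k K) B \<and> p_independent (adjoin_powers k K) B"
  using subfieldE(3)[OF assms] pow_in_adjoin_powers by (auto simp: r_base_def p_independent_def)

lemma p_independent_chain_Union:
  assumes M: "M \<subseteq> carrier R" and ch: "subset.chain {B. p_independent M B} \<C>" and ne: "\<C> \<noteq> {}"
  shows "p_independent M (\<Union>\<C>)"
proof -
  have ind: "p_independent M B" if "B \<in> \<C>" for B using ch that by (auto simp: subset.chain_def)
  then have UR: "\<Union>\<C> \<subseteq> carrier R" by (auto simp: p_independent_def)
  have "x \<notin> adjoin R M (\<Union>\<C> - {x})" if x: "x \<in> \<Union>\<C>" for x
  proof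
    assume "x \<in> adjoin R M (\<Union>\<C> - {x})"
    then obtain F where F: "finite F" "F \<subseteq> \<Union>\<C> - {x}" "x \<in> adjoin R M F"
      using adjoin_finitary[OF _ M, of x "\<Union>\<C> - {x}"] UR by blast
    have "finite (insert x F)" "insert x F \<subseteq> \<Union>\<C>" using F x by auto
    then obtain B where "B \<in> \<C>" "insert x F \<subseteq> B"
      using finite_subset_Union_chain ne ch by metis
    then have B: "B \<in> \<C>" "x \<in> B" "F \<subseteq> B" by auto
    have "adjoin R M F \<subseteq> adjoin R M (B - {x})"
      using B F M UR by (intro adjoin_mono) auto
    then show False using F(3) ind[OF B(1)] B(2) by (auto simp: p_independent_def)
  qed
  then show ?thesis using ind UR by (auto simp: p_independent_def)
qed

lemma r_base_exists:
  assumes K: "subfield K R" and k: "k \<subseteq> K"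
  obtains B where "r_base R K k B"
proof -
  let ?M = "adjoin_powers k K"
  let ?A = "{B. B \<subseteq> K \<and> p_independent ?M B}"
  have KR: "K \<subseteq> carrier R" using K by (rule subfieldE(3))
  have MK: "?M \<subseteq> K" by (rule adjoin_powers_subset[OF K k])
  have MR: "?M \<subseteq> carrier R" using MK KR by simp
  have "\<exists>B\<in>?A. \<forall>D\<in>?A. B \<subseteq> D \<longrightarrow> D = B"
  proof (rule subset_Zorn_nonempty)
    have "{} \<in> ?A" by (simp add: p_independent_def)
    then show "?A \<noteq> {}" by blast
    fix \<C> assume C: "\<C> \<noteq> {}" "subset.chain ?A \<C>"
    then have "subset.chain {B. p_independent ?M B} \<C>" by (auto simp: subset.chain_def)
    then show "\<Union>\<C> \<in> ?A"
      using p_independent_chain_Union[OF MR _ C(1)] C(2) by (auto simp: subset.chain_def)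
  qed
  then obtain B where BA: "B \<in> ?A" and BM: "\<forall>D\<in>?A. B \<subseteq> D \<longrightarrow> D = B" by (rule bexE)
  have B: "B \<subseteq> K" "p_independent ?M B" using BA by simp_all
  have max: "D = B" if "D \<subseteq> K" "p_independent ?M D" "B \<subseteq> D" for D
    using BM that by simp
  have "K \<subseteq> adjoin R ?M B"
  proof (rule ccontr)
    assume "\<not> K \<subseteq> adjoin R ?M B"
    then obtain x where x: "x \<in> K" "x \<notin> adjoin R ?M B" by blast
    note ins = p_independent_insert[OF MR B(2) _ pow_in_adjoin_powers[OF x(1)] x(2)]
    have "x \<in> carrier R" using x KR by auto
    then have "insert x B = B" using ins(1) x B by (intro max) auto
    then show False using ins(2) \<open>x \<in> carrier R\<close> by auto
  qed
  moreover have "adjoin R ?M B \<subseteq> K" by (rule adjoin_least[OF K MK B(1)])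
  ultimately show thesis using that B r_base_iff_p_independent[OF K] by blast
qed

text \<open>If all \<open>p\<^bsup>n+1\<^esup>\<close>-th powers of elements of \<open>K\<close> lie in \<open>M = k(B)\<close>, then the field of those \<open>x\<close> with
\<open>p\<^sup>n\<close>-th power in \<open>M\<close> contains \<open>k\<close>, \<open>K\<^sup>p\<close> and \<open>B\<close>, and so is all of \<open>K\<close>. Hence the exponent can be
lowered to \<open>0\<close>.\<close>

lemma r_base_generates:
  assumes K: "subfield K R" and kK: "k \<subseteq> K"
    and exp: "\<And>x. x \<in> K \<Longrightarrow> x [^] (p ^ n) \<in> k" and B: "r_base R K k B"
  shows "K \<subseteq> adjoin R k B"
proof -
  let ?M = "adjoin R k B"
  have KR: "K \<subseteq> carrier R" using K by (rule subfieldE(3))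
  have BK: "B \<subseteq> K" and KB: "K = adjoin R (adjoin_powers k K) B" using B by (auto simp: r_base_def)
  have M: "subfield ?M R" using kK KR BK by (intro adjoin_subfield) auto
  note pow = subfield_pow_closed[OF M]
  have "\<forall>x\<in>K. x [^] (p ^ n) \<in> ?M" using exp adjoin_base[of k B] by blast
  then show ?thesis
  proof (induction n)
    case 0
    show ?case
    proof
      fix x assume "x \<in> K"
      then have "x [^] (p ^ 0) \<in> ?M" "x \<in> carrier R" using 0 KR by auto
      then show "x \<in> ?M" by simp
    qed
  next
    case (Suc n)
    let ?P = "{x \<in> carrier R. x [^] (p ^ n) \<in> ?M}"
    have P: "subfield ?P R" by (rule subfield_frobenius_preimage[OF M])
    have "k \<subseteq> ?P" "B \<subseteq> ?P"
      using pow adjoin_base[of k B] adjoin_gens[of B k] kK KR BK by auto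
    moreover have "char_powers R K \<subseteq> ?P"
      using Suc.prems KR by (auto simp: char_powers_def nat_pow_pow)
    ultimately have "adjoin R (adjoin_powers k K) B \<subseteq> ?P" by (intro adjoin_least P)
    then show ?case using KB by (intro Suc.IH) auto
  qed
qed

text \<open>\<open>|C| \<le> |B|\<close> cannot be had in general by climbing from \<open>L\<close> to \<open>K\<close>, as this takes infinitely many
steps. For infinite \<open>B\<close> the finite bound is therefore only used to see that each \<open>k(F)\<close> with finite
\<open>F \<subseteq> B\<close> contains finitely many members of \<open>C\<close>.\<close>

lemma r_base_card_mono:
  assumes K: "subfield K R" and L: "subfield L R" and k: "subfield k R" and kL: "k \<subseteq> L" and LK: "L \<subseteq> K"
    and exp: "\<And>x. x \<in> K \<Longrightarrow> x [^] (p ^ n) \<in> k"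
    and B: "r_base R K k B" and C: "r_base R L k C"
  shows "|C| \<le>o |B|"
proof -
  have KR: "K \<subseteq> carrier R" using K by (rule subfieldE(3))
  have BK: "B \<subseteq> K" using B by (simp add: r_base_def)
  have CL: "C \<subseteq> L" and Ci: "p_independent (adjoin_powers k L) C"
    using C r_base_iff_p_independent[OF L] by auto
  have KB: "K \<subseteq> adjoin R k B" using r_base_generates[OF K _ exp B] kL LK by blast
  have pR: "adjoin_powers k L \<subseteq> carrier R" using adjoin_powers_subset[OF L kL] LK KR by blast
  have bound: "card D \<le> card F"
    if "D \<subseteq> C" "finite D" "F \<subseteq> B" "finite F" "D \<subseteq> adjoin R k F" for D F
  proof (rule p_independent_finite_bound[OF kL L])
    show "p_independent (adjoin_powers k L) D"
      using that CL by (intro p_independent_antimono[OF Ci _ _ pR] pow_in_adjoin_powers) auto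
    show "\<exists>n. x [^] (p ^ n) \<in> k" if "x \<in> F" for x
      using that \<open>F \<subseteq> B\<close> BK exp by blast
  qed (use that CL BK KR in auto)
  have fin: "finite (C \<inter> adjoin R k F)" if F: "F \<subseteq> B" "finite F" for F
  proof (rule ccontr)
    assume "infinite (C \<inter> adjoin R k F)"
    then obtain D where "finite D" "card D = Suc (card F)" "D \<subseteq> C \<inter> adjoin R k F"
      using infinite_arbitrarily_large by blast
    then show False using bound[of D F] F by auto
  qed
  show ?thesis
  proof (cases "finite B")
    case True
    have "C \<inter> adjoin R k B = C" using CL LK KB by blast
    then have "finite C" "card C \<le> card B" using fin[of B] bound[of C B] True by auto
    then show ?thesis using True by (simp add: card_of_ordLeq[symmetric] inj_on_iff_card_le)
  next
    case False
    have "C \<subseteq> (\<Union>F\<in>Fpow B. C \<inter> adjoin R k F)"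
    proof
      fix x assume x: "x \<in> C"
      then have "x \<in> adjoin R k B" using CL LK KB by blast
      then obtain F where "finite F" "F \<subseteq> B" "x \<in> adjoin R k F"
        using adjoin_finitary[of x k B] BK KR subfieldE(3)[OF k] by blast
      then show "x \<in> (\<Union>F\<in>Fpow B. C \<inter> adjoin R k F)" using x by (auto simp: Fpow_def)
    qed
    moreover have "|\<Union>F\<in>Fpow B. C \<inter> adjoin R k F| \<le>o |B|"
    proof (rule card_of_UNION_ordLeq_infinite[OF False])
      show "|Fpow B| \<le>o |B|" using card_of_Fpow_infinite[OF False] by (rule ordIso_imp_ordLeq)
      show "\<forall>F\<in>Fpow B. |C \<inter> adjoin R k F| \<le>o |B|"
        using fin False by (auto simp: Fpow_def intro!: ordLess_imp_ordLeq finite_ordLess_infinite2)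
    qed
    ultimately show ?thesis using card_of_mono1 ordLeq_transitive by blast
  qed
qed

lemma subfield_Int:
  assumes "subfield K R" "subfield L R"
  shows "subfield (K \<inter> L) R"
proof -
  have KL: "K \<inter> L \<subseteq> carrier R" using subfieldE(3)[OF assms(1)] by blast
  have "generate_field R (K \<inter> L) = K \<inter> L"
    using generate_field_min_subfield1[OF KL assms(1)] generate_field_min_subfield1[OF KL assms(2)]
    by (auto intro: generate_field.incl)
  then show ?thesis using generate_field_is_subfield[OF KL] by simp
qed

lemma root_subfield_subfield:
  assumes "subfield K R" "subfield k R"
  shows "subfield (root_subfield R K k n) R"
proof -
  have "root_subfield R K k n = K \<inter> {x \<in> carrier R. x [^] (p ^ n) \<in> k}"
    using subfieldE(3)[OF assms(1)] by (auto simp: root_subfield_def)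
  then show ?thesis using subfield_Int subfield_frobenius_preimage assms by simp
qed

lemma base_subset_root_subfield:
  assumes "subfield k R" "k \<subseteq> K"
  shows "k \<subseteq> root_subfield R K k n"
  using assms by (auto simp: root_subfield_def subfield_pow_closed)

section \<open>The degree of irrationality\<close>

lemma is_card_Sup_irrationality_degree:
  "is_card_Sup {|SOME B. r_base R (root_subfield R K k n) k B| | n. n \<ge> 1} (irrationality_degree R K k)"
  unfolding irrationality_degree_def by (rule is_card_Sup_card_Sup) (auto simp: card_of_Card_order)

text \<open>The definition of the degree chooses r-bases of the \<open>n\<close>-th root subfields arbitrarily; the existence
of r-bases makes the choices meaningful, and the comparison holds for any choice.\<close>

lemma irrationality_degree_mono:
  assumes k: "subfield k R" and K: "subfield K R" and L: "subfield L R" and kL: "k \<subseteq> L" and LK: "L \<subseteq> K"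
  shows "irrationality_degree R L k \<le>o irrationality_degree R K k"
proof (rule is_card_Sup_least[OF is_card_Sup_irrationality_degree])
  show "Card_order (irrationality_degree R K k)"
    using is_card_Sup_irrationality_degree[of K k] by (simp add: is_card_Sup_def)
  fix s assume "s \<in> {|SOME B. r_base R (root_subfield R L k n) k B| | n. n \<ge> 1}"
  then obtain n where n: "n \<ge> 1" and s: "s = |SOME B. r_base R (root_subfield R L k n) k B|" by blast
  let ?K = "root_subfield R K k n" and ?L = "root_subfield R L k n"
  have sub: "subfield ?K R" "subfield ?L R" using root_subfield_subfield k K L by auto
  have kn: "k \<subseteq> ?K" "k \<subseteq> ?L" using base_subset_root_subfield[OF k] kL LK by auto
  have "r_base R ?K k (SOME B. r_base R ?K k B)" "r_base R ?L k (SOME B. r_base R ?L k B)"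
    using r_base_exists[OF sub(1) kn(1)] r_base_exists[OF sub(2) kn(2)] by (metis someI_ex)+
  then have "s \<le>o |SOME B. r_base R ?K k B|"
    unfolding s using LK by (intro r_base_card_mono[OF sub k kn(2)]) (auto simp: root_subfield_def)
  also have "|SOME B. r_base R ?K k B| \<le>o irrationality_degree R K k"
    using is_card_Sup_irrationality_degree[of K k] n by (auto simp: is_card_Sup_def)
  finally show "s \<le>o irrationality_degree R K k" .
qed

end

theorem mainTheorem2:
  fixes R :: "('a, 'b) ring_scheme" and K k :: "'a set"
  assumes "field R" and "ring_char R > 0"
    and "subfield k R" and "subfield K R" and "k \<subseteq> K"
    and "purely_inseparable R K k"
  shows "(\<forall>L. subfield L R \<and> k \<subseteq> L \<and> L \<subseteq> K \<longrightarrow>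
            irrationality_degree R L k \<le>o irrationality_degree R K k) \<and>
         irrationality_degree R K k =o
           card_Sup {irrationality_degree R L k | L. subfield L R \<and> k \<subseteq> L \<and> L \<subseteq> K}"
proof -
  interpret positive_char_field R
    using assms(1,2) by (simp add: positive_char_field_def positive_char_field_axioms_def)
  let ?S = "{irrationality_degree R L k | L. subfield L R \<and> k \<subseteq> L \<and> L \<subseteq> K}"
  have mono: "irrationality_degree R L k \<le>o irrationality_degree R K k"
    if "subfield L R" "k \<subseteq> L" "L \<subseteq> K" for L
    using irrationality_degree_mono[OF assms(3,4)] that by blast
  have card: "Card_order (irrationality_degree R L k)" for L
    using is_card_Sup_irrationality_degree[of L k] by (simp add: is_card_Sup_def)
  have sup: "is_card_Sup ?S (card_Sup ?S)"
    using card by (intro is_card_Sup_card_Sup) auto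
  have "irrationality_degree R K k \<le>o card_Sup ?S"
    using sup assms(4,5) unfolding is_card_Sup_def by blast
  moreover have "card_Sup ?S \<le>o irrationality_degree R K k"
    using mono by (intro is_card_Sup_least[OF sup card]) auto
  ultimately show ?thesis
    using mono by (simp add: ordIso_iff_ordLeq)
qed

end
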